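(* Let $\pi\colon(\Omega,\mathrm{pr})\to(\Omega',\mathrm{pr}')$ be a bundle of probability schemes. Then the transfer map $\pi_*$ satisfies the projection formula $$\pi_*((\pi^{\sharp}Z)X)=Z\,\pi_*X\qquad\text{for all }Z\in\mathbb{R}^{\Omega'},\ X\in\mathbb{R}^{\Omega};$$ that is, $\pi_*$ is an $\mathbb{R}^{\Omega'}$-module map when $\mathbb{R}^{\Omega}$ is regarded as an $\mathbb{R}^{\Omega'}$-module through $\pi^{\sharp}$.
   Context: A (probability) scheme is a finite set $\Omega$ with a function $\mathrm{pr}\colon\Omega\to(0,\infty)$ such that $\sum_{\omega}\mathrm{pr}(\omega)=1$. $\mathbb{R}^{\Omega}$ is the real algebra of functions $\Omega\to\mathbb{R}$ under pointwise operations. A bundle is a map $\pi\colon\Omega\to\Omega'$ of schemes with $\mathrm{pr}'(\omega')=\sum_{\omega\in\pi^{-1}(\omega')}\mathrm{pr}(\omega)$ for all $\omega'\in\Omega'$ (hence surjective). The pullback is $\pi^{\sharp}\colon\mathbb{R}^{\Omega'}\to\mathbb{R}^{\Omega}$, $\pi^{\sharp}(Z)=Z\circ\pi$, and the transfer $\pi_*\colon\mathbb{R}^{\Omega}\to\mathbb{R}^{\Omega'}$ is $(\pi_*X)(\omega')=\sum_{\omega\in\pi^{-1}(\omega')}X(\omega)$. *)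

theory Defs
  imports Complex_Main "HOL-Library.Function_Algebras"
begin

text \<open>
  The finite set underlying a scheme is a type of class \<open>finite\<close>. The algebra of real functions
  on it is \<open>'a \<Rightarrow> real\<close> with the pointwise operations of \<open>Function_Algebras\<close>; in particular \<open>*\<close>
  on functions is the pointwise product.
\<close>

definition prob_scheme :: "('a::finite \<Rightarrow> real) \<Rightarrow> bool" where
  "prob_scheme pr \<longleftrightarrow> (\<forall>w. 0 < pr w) \<and> (\<Sum>w\<in>UNIV. pr w) = 1"

definition bundle_map ::
  "('a::finite \<Rightarrow> real) \<Rightarrow> ('b::finite \<Rightarrow> real) \<Rightarrow> ('a \<Rightarrow> 'b) \<Rightarrow> bool" where
  "bundle_map pr pr' \<pi> \<longleftrightarrow>
     prob_scheme pr \<and> prob_scheme pr' \<and> (\<forall>w'. pr' w' = (\<Sum>w\<in>\<pi> -` {w'}. pr w))"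

definition pullback :: "('a::finite \<Rightarrow> 'b::finite) \<Rightarrow> ('b \<Rightarrow> real) \<Rightarrow> ('a \<Rightarrow> real)" where
  "pullback \<pi> Z = Z \<circ> \<pi>"

definition transfer_map :: "('a::finite \<Rightarrow> 'b::finite) \<Rightarrow> ('a \<Rightarrow> real) \<Rightarrow> ('b \<Rightarrow> real)" where
  "transfer_map \<pi> X = (\<lambda>w'. \<Sum>w\<in>\<pi> -` {w'}. X w)"

end

theory Submission
  imports Defs
begin

text \<open>On the fibre of \<pi> over \<open>w'\<close>, \<open>pullback \<pi> Z\<close> is
  constant with value \<open>Z w'\<close>, so this factor comes out of the fibre sum:
  \<open>transfer_map_pullback_mult\<close>. With \<open>transfer_map_add\<close> this gives
  linearity, since the projection formula is exactly compatibility with scalars.\<close>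

lemma transfer_map_add: "transfer_map \<pi> (X + Y) = transfer_map \<pi> X + transfer_map \<pi> Y"
  by (simp add: transfer_map_def fun_eq_iff sum.distrib)

lemma transfer_map_pullback_mult:
  "transfer_map \<pi> (pullback \<pi> Z * X) = Z * transfer_map \<pi> X"
  by (simp add: transfer_map_def pullback_def fun_eq_iff sum_distrib_left)

text \<open>Restriction of scalars: \<open>pullback \<pi>\<close> preserves sums, products and 1, so
  the module axioms reduce pointwise to ring laws in the reals.\<close>

lemma module_pullback_mult: "module (\<lambda>Z X. pullback \<pi> Z * X)"
  by unfold_locales (simp_all add: pullback_def fun_eq_iff algebra_simps)

lemma module_fun_mult: "module (\<lambda>(Z :: 'b \<Rightarrow> real) Y. Z * Y)"
  by unfold_locales (simp_all add: fun_eq_iff algebra_simps)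

theorem mainTheorem8:
  fixes pr :: "'a::finite \<Rightarrow> real" and pr' :: "'b::finite \<Rightarrow> real" and \<pi> :: "'a \<Rightarrow> 'b"
  assumes "bundle_map pr pr' \<pi>"
  shows "(\<forall>(Z :: 'b \<Rightarrow> real) (X :: 'a \<Rightarrow> real).
            transfer_map \<pi> (pullback \<pi> Z * X) = Z * transfer_map \<pi> X) \<and>
         module_hom (\<lambda>(Z :: 'b \<Rightarrow> real) (X :: 'a \<Rightarrow> real). pullback \<pi> Z * X)
                    (\<lambda>(Z :: 'b \<Rightarrow> real) (Y :: 'b \<Rightarrow> real). Z * Y)
                    (transfer_map \<pi>)"
  by (simp add: module_hom_def module_hom_axioms_def module_pullback_mult module_fun_mult
      transfer_map_add transfer_map_pullback_mult)

end
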